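(* Let $0<a_1<\dots<a_n$ be real numbers and let $\vec{C}=(c_1,\dots,c_n)$ be an ordering of them. Let $u'=\lfloor n/2\rfloor$ and suppose there is at least one $k$ with $2\le k\le u'$ and $c_k>c_{n+1-k}$. Let $\vec{C}'$ be obtained from $\vec{C}$ by interchanging the entries in positions $k$ and $n+1-k$ for every $k$ with $2\le k\le u'$ and $c_k>c_{n+1-k}$ (leaving all other entries unchanged), so that $c'_k<c'_{n+1-k}$ for all $2\le k\le u'$ (the sum-`$n+1$' transform). Then $f(\vec{C}')>f(\vec{C})$.
   Context: For an ordering $\vec{C}=(c_1,\dots,c_n)$ of $a_1,\dots,a_n$, its partial sums are $s_k=\sum_{i=1}^k c_i$, with mean $\overline{S}=\frac1n\sum_{k=1}^n s_k$, and $f(\vec{C})=\frac1n\sum_{k=1}^n (s_k-\overline{S})^2$ is the variance of the partial sums. *)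

theory Defs
  imports Complex_Main "HOL-Combinatorics.Permutations"
begin

text \<open>
  Sequences of length \<open>n\<close> are functions \<open>nat \<Rightarrow> real\<close>
  of which only the values at the positions \<open>1, \<dots>, n\<close> matter.
\<close>

definition is_ordering :: "nat \<Rightarrow> (nat \<Rightarrow> real) \<Rightarrow> (nat \<Rightarrow> real) \<Rightarrow> bool" where
  "is_ordering n a c \<longleftrightarrow>
     (\<exists>\<sigma>. \<sigma> permutes {1..n} \<and> (\<forall>i\<in>{1..n}. c i = a (\<sigma> i)))"

definition partial_sum :: "(nat \<Rightarrow> real) \<Rightarrow> nat \<Rightarrow> real" where
  "partial_sum c k = (\<Sum>i=1..k. c i)"

definition mean_partial_sums :: "nat \<Rightarrow> (nat \<Rightarrow> real) \<Rightarrow> real" where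
  "mean_partial_sums n c = (1 / real n) * (\<Sum>k=1..n. partial_sum c k)"

definition var_partial_sums :: "nat \<Rightarrow> (nat \<Rightarrow> real) \<Rightarrow> real" where
  "var_partial_sums n c =
     (1 / real n) * (\<Sum>k=1..n. (partial_sum c k - mean_partial_sums n c)\<^sup>2)"

definition swap_index :: "nat \<Rightarrow> (nat \<Rightarrow> real) \<Rightarrow> nat \<Rightarrow> bool" where
  "swap_index n c k \<longleftrightarrow> 2 \<le> k \<and> k \<le> n div 2 \<and> c k > c (n + 1 - k)"

text \<open>
  All interchanges are performed simultaneously: position \<open>i\<close> takes part in one if it is
  either the left position \<open>k\<close> or the right position \<open>n + 1 - k\<close> of a pair to be swapped.
\<close>

definition sum_transform :: "nat \<Rightarrow> (nat \<Rightarrow> real) \<Rightarrow> nat \<Rightarrow> real" where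
  "sum_transform n c i =
     (if swap_index n c i \<or> swap_index n c (n + 1 - i) then c (n + 1 - i) else c i)"

lemma sum_transform_less:
  assumes "strict_mono_on {1..n} a" "is_ordering n a c" "2 \<le> k" "k \<le> n div 2"
  shows "sum_transform n c k < sum_transform n c (n + 1 - k)"
proof -
  from assms(2) obtain p where p: "p permutes {1..n}" "\<forall>i\<in>{1..n}. c i = a (p i)"
    unfolding is_ordering_def by blast
  have k: "k \<in> {1..n}" "n + 1 - k \<in> {1..n}" "k \<noteq> n + 1 - k" "n + 1 - (n + 1 - k) = k"
    using assms(3,4) by auto
  have "p k \<noteq> p (n + 1 - k)"
    using permutes_inj[OF p(1)] k(3) by (auto dest: injD)
  moreover have "p k \<in> {1..n}" "p (n + 1 - k) \<in> {1..n}"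
    using permutes_in_image[OF p(1)] k by auto
  ultimately have "a (p k) \<noteq> a (p (n + 1 - k))"
    using strict_mono_on_imp_inj_on[OF assms(1)] by (meson inj_onD)
  hence "c k \<noteq> c (n + 1 - k)"
    using p(2) k by simp
  moreover have "\<not> swap_index n c (n + 1 - k)"
    using assms(3,4) by (auto simp: swap_index_def)
  ultimately show ?thesis
    using assms(3,4) k(4) unfolding sum_transform_def k(4) by (auto simp: swap_index_def)
qed

end

theory Submission
  imports Defs
begin

text \<open>
  Let \<open>s\<close>, \<open>s'\<close> be the partial sums before and after the transform, \<open>D = s - s'\<close> and
  \<open>t = s + s'\<close>. The variance increases iff \<open>D\<close> and \<open>t\<close> are negatively correlated on \<open>{1..n}\<close>.
  Now \<open>D j = D (n - j)\<close>, and \<open>D\<close> is nonnegative, vanishes at \<open>n\<close> and is nondecreasing up to the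
  middle, so on \<open>{1..n-1}\<close> one may replace \<open>t\<close> by its symmetrisation \<open>u j = t j + t (n - j)\<close>. This
  is nonincreasing up to the middle: a swapped pair does not contribute to its increments and an
  unswapped one contributes \<open>2 * (c k - c (n + 1 - k)) \<le> 0\<close>. Chebyshev's sum inequality thus gives
  a nonpositive correlation on \<open>{1..n-1}\<close>. It becomes negative when the index \<open>n\<close> is added, because
  \<open>D n = 0\<close> is below the mean of \<open>D\<close>, while \<open>t n\<close> is the largest value of \<open>t\<close>.
\<close>

text \<open>Expanding the product gives this form of the covariance, whose sign can be read off from
  the signs of the pairwise products.\<close>

lemma sum_sum_diff_mult_diff:
  fixes x y :: "'a \<Rightarrow> real"
  shows "(\<Sum>i\<in>A. \<Sum>j\<in>A. (x i - x j) * (y i - y j)) =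
    2 * (real (card A) * (\<Sum>i\<in>A. x i * y i) - sum x A * sum y A)"
proof -
  have "(\<Sum>i\<in>A. \<Sum>j\<in>A. (x i - x j) * (y i - y j)) =
     (\<Sum>i\<in>A. \<Sum>j\<in>A. x i * y i + x j * y j - x i * y j - x j * y i)"
    by (intro sum.cong) (auto simp: algebra_simps)
  also have "\<dots> = 2 * (real (card A) * (\<Sum>i\<in>A. x i * y i)) - 2 * (sum x A * sum y A)"
    by (simp add: sum.distrib sum_subtractf flip: sum_distrib_left sum_distrib_right)
  finally show ?thesis by simp
qed

text \<open>By symmetry \<open>x\<close> and \<open>y\<close> depend only on the distance
  \<open>min i (n - i)\<close> to the nearer end, and in that distance they are oppositely monotone.
  Hence every product \<open>(x i - x j) * (y i - y j)\<close> is nonpositive.\<close>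

lemma Chebyshev_sum_symmetric:
  fixes x y :: "nat \<Rightarrow> real"
  assumes x_sym: "\<And>i. i \<le> n \<Longrightarrow> x (n - i) = x i"
    and y_sym: "\<And>i. i \<le> n \<Longrightarrow> y (n - i) = y i"
    and x_mono: "\<And>i j. 1 \<le> i \<Longrightarrow> i \<le> j \<Longrightarrow> j \<le> n div 2 \<Longrightarrow> x i \<le> x j"
    and y_anti: "\<And>i j. 1 \<le> i \<Longrightarrow> i \<le> j \<Longrightarrow> j \<le> n div 2 \<Longrightarrow> y j \<le> y i"
  shows "real (n - 1) * (\<Sum>i=1..n-1. x i * y i) \<le> (\<Sum>i=1..n-1. x i) * (\<Sum>i=1..n-1. y i)"
proof -
  define h where "h i = min i (n - i)" for i
  have h: "x i = x (h i)" "y i = y (h i)" "1 \<le> h i" "h i \<le> n div 2" if "i \<in> {1..n-1}" for i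
    using that x_sym[of i] y_sym[of i] by (auto simp: h_def min_def)
  have "(x i - x j) * (y i - y j) \<le> 0" if "i \<in> {1..n-1}" "j \<in> {1..n-1}" for i j
  proof (cases "h i \<le> h j")
    case True
    then have "x i \<le> x j" "y j \<le> y i"
      using x_mono[of "h i" "h j"] y_anti[of "h i" "h j"] h[OF that(1)] h[OF that(2)] by auto
    then show ?thesis by (simp add: mult_nonpos_nonneg)
  next
    case False
    then have "x j \<le> x i" "y i \<le> y j"
      using x_mono[of "h j" "h i"] y_anti[of "h j" "h i"] h[OF that(1)] h[OF that(2)] by auto
    then show ?thesis by (simp add: mult_nonneg_nonpos)
  qed
  then have "(\<Sum>i\<in>{1..n-1}. \<Sum>j\<in>{1..n-1}. (x i - x j) * (y i - y j)) \<le> 0"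
    by (intro sum_nonpos) auto
  then show ?thesis
    unfolding sum_sum_diff_mult_diff by simp
qed

text \<open>Variance as mean square minus squared mean, scaled to clear denominators.\<close>

lemma var_partial_sums_eq:
  assumes "n > 0"
  shows "(real n)\<^sup>2 * var_partial_sums n c =
    real n * (\<Sum>k=1..n. (partial_sum c k)\<^sup>2) - (\<Sum>k=1..n. partial_sum c k)\<^sup>2"
proof -
  define S where "S = (\<Sum>k=1..n. partial_sum c k)"
  define m where "m = mean_partial_sums n c"
  have m: "real n * m = S"
    using assms by (simp add: m_def S_def mean_partial_sums_def)
  have "(\<Sum>k=1..n. (partial_sum c k - m)\<^sup>2) =
      (\<Sum>k=1..n. (partial_sum c k)\<^sup>2 - (2 * m) * partial_sum c k + m\<^sup>2)"
    by (intro sum.cong) (auto simp: power2_eq_square algebra_simps)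
  also have "\<dots> = (\<Sum>k=1..n. (partial_sum c k)\<^sup>2) - (2 * m) * S + real n * m\<^sup>2"
    by (simp add: sum.distrib sum_subtractf S_def flip: sum_distrib_left)
  finally have "(real n)\<^sup>2 * var_partial_sums n c =
      real n * ((\<Sum>k=1..n. (partial_sum c k)\<^sup>2) - (2 * m) * S + real n * m\<^sup>2)"
    using assms by (simp add: var_partial_sums_def m_def power2_eq_square)
  also have "\<dots> = real n * (\<Sum>k=1..n. (partial_sum c k)\<^sup>2) - S\<^sup>2"
    unfolding m[symmetric] by (simp add: power2_eq_square algebra_simps)
  finally show ?thesis by (simp add: S_def)
qed

text \<open>Both the sum of squares and the squared sum enter as differences of two squares, which
  factor through \<open>D\<close> and \<open>t\<close>.\<close>

lemma var_partial_sums_less_iff: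
  fixes c c' :: "nat \<Rightarrow> real"
  assumes "n > 0"
  defines "D \<equiv> \<lambda>k. partial_sum c k - partial_sum c' k"
    and "t \<equiv> \<lambda>k. partial_sum c k + partial_sum c' k"
  shows "var_partial_sums n c < var_partial_sums n c' \<longleftrightarrow>
    real n * (\<Sum>k=1..n. D k * t k) < (\<Sum>k=1..n. D k) * (\<Sum>k=1..n. t k)"
proof -
  have 1: "(\<Sum>k=1..n. D k * t k) =
      (\<Sum>k=1..n. (partial_sum c k)\<^sup>2) - (\<Sum>k=1..n. (partial_sum c' k)\<^sup>2)"
    by (simp add: D_def t_def power2_eq_square algebra_simps flip: sum_subtractf)
  have 2: "(\<Sum>k=1..n. D k) * (\<Sum>k=1..n. t k) =
      (\<Sum>k=1..n. partial_sum c k)\<^sup>2 - (\<Sum>k=1..n. partial_sum c' k)\<^sup>2"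
    by (simp add: D_def t_def sum.distrib sum_subtractf power2_eq_square algebra_simps)
  have "var_partial_sums n c < var_partial_sums n c' \<longleftrightarrow>
      (real n)\<^sup>2 * var_partial_sums n c < (real n)\<^sup>2 * var_partial_sums n c'"
    using assms(1) by simp
  also have "\<dots> \<longleftrightarrow> real n * (\<Sum>k=1..n. D k * t k) < (\<Sum>k=1..n. D k) * (\<Sum>k=1..n. t k)"
    unfolding var_partial_sums_eq[OF assms(1)] 1 2 by (auto simp: algebra_simps)
  finally show ?thesis .
qed

lemma partial_sum_0 [simp]: "partial_sum c 0 = 0"
  by (simp add: partial_sum_def)

lemma partial_sum_Suc [simp]: "partial_sum c (Suc k) = partial_sum c k + c (Suc k)"
  by (simp add: partial_sum_def)

lemma partial_sum_mono:
  assumes "\<And>i. i \<in> {1..n} \<Longrightarrow> 0 < c i" "j \<le> k" "k \<le> n"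
  shows "partial_sum c j \<le> partial_sum c k"
  unfolding partial_sum_def using assms by (intro sum_mono2) (auto intro: less_imp_le)

lemma is_ordering_pos:
  fixes a :: "nat \<Rightarrow> real"
  assumes "0 < a 1" "strict_mono_on {1..n} a" "is_ordering n a c" "i \<in> {1..n}"
  shows "0 < c i"
proof -
  obtain p where p: "p permutes {1..n}" "\<forall>i\<in>{1..n}. c i = a (p i)"
    using assms(3) by (auto simp: is_ordering_def)
  have pi: "p i \<in> {1..n}"
    using permutes_in_image[OF p(1)] assms(4) by simp
  have "a 1 \<le> a (p i)"
    using pi by (intro strict_mono_on_leD[OF assms(2)]) auto
  with assms(1,4) p(2) show ?thesis by auto
qed

lemma sum_transform_pos:
  assumes "\<And>i. i \<in> {1..n} \<Longrightarrow> 0 < c i" "i \<in> {1..n}"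
  shows "0 < sum_transform n c i"
proof -
  have "n + 1 - i \<in> {1..n}" using assms(2) by auto
  then show ?thesis using assms unfolding sum_transform_def by presburger
qed

lemma sum_transform_reflect:
  assumes "i \<in> {1..n}"
  shows "sum_transform n c i + sum_transform n c (n + 1 - i) = c i + c (n + 1 - i)"
proof -
  have "n + 1 - (n + 1 - i) = i" using assms by auto
  then show ?thesis by (auto simp: sum_transform_def)
qed

text \<open>A swap moves the smaller entry of its pair to the left half. Position 1 is never
  swapped, so equality holds there.\<close>

lemma sum_transform_le:
  assumes "1 \<le> k" "k \<le> n div 2"
  shows "sum_transform n c k \<le> c k"
proof -
  have "\<not> swap_index n c (n + 1 - k)" using assms by (auto simp: swap_index_def)
  then show ?thesis by (auto simp: sum_transform_def swap_index_def)
qed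

text \<open>A swapped pair gives equality, and an unswapped one is already in increasing order. The
  pair of positions 1 and \<open>n\<close> is excluded because it stays put even if
  decreasing.\<close>

lemma add_sum_transform_le_reflect:
  assumes "2 \<le> k" "k \<le> n div 2"
  shows "c k + sum_transform n c k \<le> c (n + 1 - k) + sum_transform n c (n + 1 - k)"
proof -
  have "n + 1 - (n + 1 - k) = k" "\<not> swap_index n c (n + 1 - k)"
    using assms by (auto simp: swap_index_def)
  then show ?thesis using assms by (auto simp: sum_transform_def swap_index_def)
qed

text \<open>The two sums differ by a block of positions symmetric about the middle, in which
  \<open>d i\<close> cancels against \<open>d (n + 1 - i)\<close>. For \<open>j = 0\<close> the
  block is everything, and reversing the sum shows that it equals its own negative.\<close>

lemma partial_sum_reflect:
  assumes anti: "\<And>i. i \<in> {1..n} \<Longrightarrow> d (n + 1 - i) = - d i" and "j \<le> n"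
  shows "partial_sum d (n - j) = partial_sum d j"
  using \<open>j \<le> n\<close>
proof (induction j)
  case 0
  have "partial_sum d n = (\<Sum>i=1..n. d (n + 1 - i))"
    unfolding partial_sum_def by (subst sum.atLeastAtMost_rev) simp
  also have "\<dots> = - partial_sum d n"
    unfolding partial_sum_def sum_negf[symmetric] by (intro sum.cong refl anti)
  finally show ?case by simp
next
  case (Suc j)
  have "partial_sum d (n - j) = partial_sum d (n - Suc j) + d (n - j)"
    using Suc.prems partial_sum_Suc[of d "n - Suc j"] by (simp add: Suc_diff_Suc)
  moreover have "d (n - j) = - d (Suc j)"
    using anti[of "Suc j"] Suc.prems by simp
  ultimately show ?case using Suc by simp
qed

theorem theorem2:
  fixes n :: nat and a c :: "nat \<Rightarrow> real"
  assumes "0 < a 1"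
    and "strict_mono_on {1..n} a"
    and "is_ordering n a c"
    and "\<exists>k. 2 \<le> k \<and> k \<le> n div 2 \<and> c k > c (n + 1 - k)"
  shows "var_partial_sums n (sum_transform n c) > var_partial_sums n c"
proof -
  define c' where "c' = sum_transform n c"
  define D where "D = (\<lambda>k. partial_sum c k - partial_sum c' k)"
  define t where "t = (\<lambda>k. partial_sum c k + partial_sum c' k)"
  define u where "u = (\<lambda>k. t k + t (n - k))"
  obtain k where k: "2 \<le> k" "k \<le> n div 2" "c k > c (n + 1 - k)"
    using assms(4) by blast
  then have n: "n \<ge> 4" by simp
  have c_pos: "0 < c i" if "i \<in> {1..n}" for i
    using is_ordering_pos[OF assms(1-3) that] .
  have c'_pos: "0 < c' i" if "i \<in> {1..n}" for i
    unfolding c'_def using sum_transform_pos c_pos that by blast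

  have D_eq: "D = partial_sum (\<lambda>i. c i - c' i)"
    by (simp add: D_def partial_sum_def sum_subtractf fun_eq_iff)
  have D_sym: "D (n - j) = D j" if "j \<le> n" for j
    unfolding D_eq
  proof (rule partial_sum_reflect[OF _ that])
    fix i assume "i \<in> {1..n}"
    then show "c (n + 1 - i) - c' (n + 1 - i) = - (c i - c' i)"
      using sum_transform_reflect[of i n c] by (simp add: c'_def)
  qed
  have D_mono: "D i \<le> D j" if "i \<le> j" "j \<le> n div 2" for i j
    using that
  proof (induction j rule: dec_induct)
    case (step m)
    then show ?case using sum_transform_le[of "Suc m" n c] by (simp add: D_def c'_def)
  qed simp
  have D_nonneg: "0 \<le> D i" if "i \<le> n" for i
  proof (cases "i \<le> n div 2")
    case True
    then show ?thesis using D_mono[of 0 i] by (simp add: D_def)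
  next
    case False
    then have "n - i \<le> n div 2" by linarith
    then show ?thesis using D_mono[of 0 "n - i"] D_sym[OF that] by (simp add: D_def)
  qed
  have D_n: "D n = 0"
    using D_sym[of 0] by (simp add: D_def)
  \<comment> \<open>The genuine swap at \<open>k\<close> makes \<open>D\<close> jump up there, so
    the sum of \<open>D\<close> is positive and the final inequality can be strict.\<close>
  have "D k > 0"
  proof -
    have "c' k = c (n + 1 - k)"
      using k by (simp add: c'_def sum_transform_def swap_index_def)
    moreover have "D k = D (k - 1) + (c k - c' k)"
      using k partial_sum_Suc[of _ "k - 1"] by (simp add: D_def)
    moreover have "0 \<le> D (k - 1)"
      using k by (intro D_nonneg) simp
    ultimately show ?thesis using k(3) by linarith
  qed
  then have D_pos: "0 < (\<Sum>i=1..n-1. D i)"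
    using k by (intro sum_pos2[of _ k]) (auto intro: D_nonneg)

  have u_sym: "u (n - i) = u i" if "i \<le> n" for i
    using that by (simp add: u_def)
  \<comment> \<open>The increment of \<open>u\<close> from \<open>m\<close> to \<open>Suc m\<close>
    compares positions \<open>Suc m\<close> and \<open>n - m\<close>, which form a reflected pair.
    Starting at 1 rather than 0 avoids the outermost pair.\<close>
  have u_anti: "u j \<le> u i" if "1 \<le> i" "i \<le> j" "j \<le> n div 2" for i j
    using that(2,3,1)
  proof (induction j rule: dec_induct)
    case (step m)
    then have "n - m = Suc (n - Suc m)" by simp
    then have "t (n - m) = t (n - Suc m) + (c (n - m) + c' (n - m))"
      by (simp add: t_def)
    moreover have "c (Suc m) + c' (Suc m) \<le> c (n - m) + c' (n - m)"
      using add_sum_transform_le_reflect[of "Suc m" n c] step by (simp add: c'_def)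
    ultimately have "u (Suc m) \<le> u m"
      by (simp add: u_def t_def)
    then show ?case using step by simp
  qed simp
  have rev: "(\<Sum>i=1..n-1. g (n - i)) = (\<Sum>i=1..n-1. g i)" for g :: "nat \<Rightarrow> real"
    using n by (subst (2) sum.atLeastAtMost_rev) simp
  have sum_u: "(\<Sum>i=1..n-1. u i) = 2 * (\<Sum>i=1..n-1. t i)"
    by (simp only: u_def sum.distrib rev[of t] mult_2)
  \<comment> \<open>The symmetry of \<open>D\<close> lets the reflected half of \<open>u\<close> be
    reindexed together with \<open>D\<close>.\<close>
  have sum_Du: "(\<Sum>i=1..n-1. D i * u i) = 2 * (\<Sum>i=1..n-1. D i * t i)"
  proof -
    have "(\<Sum>i=1..n-1. D i * u i) = (\<Sum>i=1..n-1. D i * t i + D (n - i) * t (n - i))"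
      by (intro sum.cong) (auto simp: u_def D_sym algebra_simps)
    then show ?thesis
      by (simp only: sum.distrib rev[of "\<lambda>i. D i * t i"] mult_2)
  qed
  have "real (n - 1) * (\<Sum>i=1..n-1. D i * u i) \<le> (\<Sum>i=1..n-1. D i) * (\<Sum>i=1..n-1. u i)"
    using u_sym by (intro Chebyshev_sum_symmetric D_sym D_mono u_anti) auto
  then have cheb: "real (n - 1) * (\<Sum>i=1..n-1. D i * t i) \<le>
      (\<Sum>i=1..n-1. D i) * (\<Sum>i=1..n-1. t i)"
    unfolding sum_u sum_Du by simp

  have "t i < t n" if "i \<in> {1..n-1}" for i
  proof -
    have i: "Suc i \<le> n" using that by auto
    have "t i < t (Suc i)"
      using c_pos[of "Suc i"] c'_pos[of "Suc i"] i by (simp add: t_def)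
    also have "t (Suc i) \<le> t n"
      unfolding t_def using i by (intro add_mono partial_sum_mono[of n] c_pos c'_pos) auto
    finally show ?thesis .
  qed
  then have "(\<Sum>i=1..n-1. t i) < (\<Sum>i=1..n-1. t n)"
    using n by (intro sum_strict_mono) auto
  then have t_less: "(\<Sum>i=1..n-1. t i) < real (n - 1) * t n" by simp

  have split: "(\<Sum>i=1..n. g i) = (\<Sum>i=1..n-1. g i) + g n" for g :: "nat \<Rightarrow> real"
    using n by (cases n) auto
  define P T W where "P = (\<Sum>i=1..n-1. D i)" and "T = (\<Sum>i=1..n-1. t i)"
    and "W = (\<Sum>i=1..n-1. D i * t i)"
  have "real (n - 1) * W \<le> P * T" using cheb by (simp add: P_def T_def W_def)
  also have "\<dots> < P * (real (n - 1) * t n)"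
    using t_less D_pos by (simp add: P_def T_def)
  finally have "W < P * t n" using n by (simp add: mult.left_commute)
  \<comment> \<open>Adding \<open>W < P * t n\<close> to the Chebyshev bound turns the factor
    \<open>n - 1\<close> into \<open>n\<close>. As \<open>D n = 0\<close>, including the index
    \<open>n\<close> leaves \<open>P\<close> and \<open>W\<close> unchanged and only adds
    \<open>t n\<close> to \<open>T\<close>.\<close>
  then have "real n * W < P * (T + t n)"
    using \<open>real (n - 1) * W \<le> P * T\<close> n by (simp add: of_nat_diff algebra_simps)
  then have "real n * (\<Sum>i=1..n. D i * t i) < (\<Sum>i=1..n. D i) * (\<Sum>i=1..n. t i)"
    unfolding split by (simp add: D_n P_def T_def W_def)
  then show ?thesis
    using n by (simp add: var_partial_sums_less_iff D_def t_def c'_def)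
qed

end
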